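(* Let $S\subseteq\mathbb{Z}^{+}$ and let $n$ and $q$ be positive integers. Then $$2^qF_{n,S}=\sum_{\ell=0}^n\binom{n}{\ell}F_{\ell,S}\left(\sum_{i=0}^{n-\ell}{n-\ell\brace i}_S (q)_i\right)+\sum_{\ell=1}^{q-1}2^{q-\ell-1}\left(\sum_{i=0}^n{n\brace i}_S(\ell)_i\right).$$
   Context: $\mathbb{Z}^{+}$ is the set of positive integers. For $S\subseteq\mathbb{Z}^{+}$, ${n\brace k}_S$ denotes the number of partitions of $[n]=\{1,\dots,n\}$ into exactly $k$ (non-empty) blocks such that the size of each block belongs to $S$ (so ${0\brace 0}_S=1$). The $S$-restricted Fubini number $F_{n,S}$ is the number of ordered set partitions of $[n]$ (the order of the blocks matters) all of whose block sizes belong to $S$, i.e. $F_{n,S}=\sum_{k=0}^n k!{n\brace k}_S$. $(t)_i=t(t-1)\cdots(t-i+1)$ is the falling factorial, with $(t)_0=1$. *)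

theory Defs
  imports Complex_Main "HOL-Library.Disjoint_Sets" "HOL-Combinatorics.Multiset_Permutations"
begin

definition restricted_partitions :: "nat set \<Rightarrow> nat \<Rightarrow> nat set set set" where
  "restricted_partitions S n = {P. partition_on {1..n} P \<and> (\<forall>B\<in>P. card B \<in> S)}"

definition restricted_Stirling :: "nat set \<Rightarrow> nat \<Rightarrow> nat \<Rightarrow> nat" where
  "restricted_Stirling S n k = card {P \<in> restricted_partitions S n. card P = k}"

(* An ordered set partition is the list of its blocks, each listed once. *)
definition restricted_ordered_partitions :: "nat set \<Rightarrow> nat \<Rightarrow> nat set list set" where
  "restricted_ordered_partitions S n = {Bs. distinct Bs \<and> set Bs \<in> restricted_partitions S n}"

definition restricted_Fubini :: "nat set \<Rightarrow> nat \<Rightarrow> nat" where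
  "restricted_Fubini S n = card (restricted_ordered_partitions S n)"

definition falling_fact :: "'a::comm_ring_1 \<Rightarrow> nat \<Rightarrow> 'a" where
  "falling_fact t i = (\<Prod>j<i. t - of_nat j)"

lemma finite_restricted_partitions: "finite (restricted_partitions S n)"
  unfolding restricted_partitions_def
  by (rule finite_subset[OF _ finitely_many_partition_on[of "{1..n}"]]) auto

lemma restricted_partitions_finite_card:
  assumes "P \<in> restricted_partitions S n"
  shows "finite P" and "card P \<le> n"
proof -
  have p: "partition_on {1..n} P"
    using assms by (simp add: restricted_partitions_def)
  then show fin: "finite P"
    using finite_elements by blast
  have finB: "finite B" if "B \<in> P" for B
    using partition_onD1[OF p] that by (metis Union_upper finite_atLeastAtMost finite_subset)
  have "card P = (\<Sum>B\<in>P. 1)" by simp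
  also have "\<dots> \<le> (\<Sum>B\<in>P. card B)"
  proof (rule sum_mono)
    fix B assume B: "B \<in> P"
    then have "B \<noteq> {}" using partition_onD3[OF p] by blast
    then show "1 \<le> card B" using finB[OF B] by (simp add: Suc_le_eq card_gt_0_iff)
  qed
  also have "\<dots> = card (\<Union>P)"
    using card_Union_disjoint[of P] partition_onD2[OF p] finB
    by (simp add: disjoint_def pairwise_def disjnt_def)
  also have "\<dots> = n" using partition_onD1[OF p] by (metis card_atLeastAtMost diff_Suc_1)
  finally show "card P \<le> n" .
qed

lemma restricted_Stirling_0_0: "restricted_Stirling S 0 0 = 1"
proof -
  have "{P \<in> restricted_partitions S 0. card P = 0} = {{}}"
    by (auto simp: restricted_partitions_def partition_on_empty)
  then show ?thesis by (simp add: restricted_Stirling_def)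
qed

lemma restricted_Fubini_eq_sum:
  "restricted_Fubini S n = (\<Sum>k=0..n. fact k * restricted_Stirling S n k)"
proof -
  let ?R = "restricted_partitions S n"
  have "restricted_ordered_partitions S n = (\<Union>P\<in>?R. permutations_of_set P)"
    by (auto simp: restricted_ordered_partitions_def permutations_of_set_def)
  then have "restricted_Fubini S n = card (\<Union>P\<in>?R. permutations_of_set P)"
    by (simp only: restricted_Fubini_def)
  also have "\<dots> = (\<Sum>P\<in>?R. card (permutations_of_set P))"
  proof (rule card_UN_disjoint)
    show "finite ?R" by (rule finite_restricted_partitions)
    show "\<forall>P\<in>?R. finite (permutations_of_set P)" by simp
    show "\<forall>P\<in>?R. \<forall>Q\<in>?R. P \<noteq> Q \<longrightarrow>
        permutations_of_set P \<inter> permutations_of_set Q = {}"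
      by (auto simp: permutations_of_set_def)
  qed
  also have "\<dots> = (\<Sum>P\<in>?R. fact (card P))"
    by (rule sum.cong) (auto simp: restricted_partitions_finite_card(1))
  also have "\<dots> = (\<Sum>k\<in>{0..n}. \<Sum>P\<in>{P\<in>?R. card P = k}. fact (card P))"
    by (rule sum.group[symmetric, OF finite_restricted_partitions])
      (auto dest: restricted_partitions_finite_card(2))
  also have "\<dots> = (\<Sum>k=0..n. fact k * restricted_Stirling S n k)"
    by (rule sum.cong) (auto simp: restricted_Stirling_def mult.commute)
  finally show ?thesis .
qed

end

theory Submission
  imports Defs "HOL-Computational_Algebra.Formal_Power_Series"
begin

text \<open>
  Let $E(x) = \sum_{s \in S} x^s/s!$. The exponential generating function $G_k$ of
  $n \mapsto {n \brace k}_S$ is $E^k/k!$: marking one block of a partition into $k+1$ blocks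
  gives $(k+1)\,G_{k+1} = E\,G_k$. Hence the restricted Fubini numbers have generating function
  $F = 1/(1-E)$, and $\sum_i {n \brace i}_S (q)_i$ has generating function $(1+E)^q$.
  The identity is the coefficient of $x^n$ in
  $F\,(2^q - (1+E)^q) = \sum_{l<q} 2^{q-1-l} (1+E)^l$, where the term $l = 0$ vanishes as $n > 0$.
\<close>

section \<open>Restricted partitions of an arbitrary finite set\<close>

definition block_partitions :: "nat set \<Rightarrow> 'a set \<Rightarrow> nat \<Rightarrow> 'a set set set" where
  "block_partitions S A k = {P. partition_on A P \<and> (\<forall>B\<in>P. card B \<in> S) \<and> card P = k}"

lemma finite_block_partitions: "finite A \<Longrightarrow> finite (block_partitions S A k)"
  unfolding block_partitions_def
  by (rule finite_subset[OF _ finitely_many_partition_on[of A]]) auto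

lemma image_block_partitions:
  assumes "inj_on f A" and P: "P \<in> block_partitions S A k"
  shows "(`) f ` P \<in> block_partitions S (f ` A) k"
proof -
  have p: "partition_on A P" and sz: "\<forall>B\<in>P. card B \<in> S" and k: "card P = k"
    using P by (auto simp: block_partitions_def)
  have sub: "B \<subseteq> A" if "B \<in> P" for B
    using partition_onD1[OF p] that by blast
  \<comment> \<open>\<open>partition_on_inj_image\<close> yields a partition only after the empty
    set is removed from the image, so its absence is checked first.\<close>
  have "{} \<notin> (`) f ` P"
    using partition_onD3[OF p] by auto
  then have "partition_on (f ` A) ((`) f ` P)"
    using partition_on_inj_image[OF p assms(1)] by simp
  moreover have "card (f ` B) \<in> S" if "B \<in> P" for B
    using sz that card_image[OF inj_on_subset[OF assms(1) sub[OF that]]] by simp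
  moreover have "inj_on ((`) f) P"
    using inj_on_image_Pow[OF assms(1)] sub by (meson PowI inj_on_subset subsetI)
  then have "card ((`) f ` P) = k"
    using k by (simp add: card_image)
  ultimately show ?thesis
    by (auto simp: block_partitions_def)
qed

text \<open>A bijection of the ground sets acts injectively on families of blocks. One inequality
  suffices, since exchanging \<open>A\<close> and \<open>B\<close> gives the other.\<close>

lemma card_block_partitions_le:
  assumes "finite A" "finite B" "card A = card B"
  shows "card (block_partitions S A k) \<le> card (block_partitions S B k)"
proof -
  obtain f where f: "bij_betw f A B"
    using finite_same_card_bij[OF assms] by blast
  then have inj: "inj_on f A" and im: "f ` A = B"
    by (auto simp: bij_betw_def)
  have sub: "block_partitions S A k \<subseteq> Pow (Pow A)"
    by (auto simp: block_partitions_def partition_on_def)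
  have "inj_on ((`) ((`) f)) (Pow (Pow A))"
    by (intro inj_on_image_Pow inj)
  then have "inj_on ((`) ((`) f)) (block_partitions S A k)"
    by (rule inj_on_subset[OF _ sub])
  then show ?thesis
    using image_block_partitions[OF inj, of _ S k] im finite_block_partitions[OF assms(2)]
    by (intro card_inj_on_le) auto
qed

text \<open>Deleting a block from a partition of \<open>{1..n}\<close> leaves a ground set that need
  not be an initial segment; this lemma returns such counts to
  \<open>restricted_Stirling\<close>.\<close>

lemma card_block_partitions:
  assumes "finite A"
  shows "card (block_partitions S A k) = restricted_Stirling S (card A) k"
proof -
  have "card (block_partitions S A k) = card (block_partitions S {1..card A} k)"
    using assms by (intro antisym card_block_partitions_le) auto
  also have "block_partitions S {1..card A} k = {P \<in> restricted_partitions S (card A). card P = k}"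
    by (auto simp: block_partitions_def restricted_partitions_def)
  finally show ?thesis
    by (simp add: restricted_Stirling_def)
qed

lemma sum_Pow_by_card:
  fixes f :: "nat \<Rightarrow> 'b::comm_semiring_1"
  assumes "finite A"
  shows "(\<Sum>B\<in>Pow A. f (card B)) = (\<Sum>j=0..card A. of_nat (card A choose j) * f j)"
proof -
  have "(\<Sum>B\<in>Pow A. f (card B)) = (\<Sum>j\<in>{0..card A}. \<Sum>B\<in>{B\<in>Pow A. card B = j}. f (card B))"
    using assms by (intro sum.group[symmetric]) (auto intro: card_mono)
  also have "\<dots> = (\<Sum>j=0..card A. of_nat (card A choose j) * f j)"
    using assms by (intro sum.cong) (auto simp: n_subsets)
  finally show ?thesis .
qed

text \<open>Double counting of pairs of a partition \<open>P\<close> and a marked block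
  \<open>B\<close>: \<open>?X\<close> lists them by \<open>P\<close>, with \<open>Suc k\<close>
  choices of \<open>B\<close> each, and \<open>?Y\<close> by \<open>B\<close> together with the
  partition left on its complement.\<close>

lemma restricted_Stirling_Suc:
  assumes S: "S \<subseteq> {0<..}"
  shows "Suc k * restricted_Stirling S n (Suc k) =
    (\<Sum>j=0..n. (n choose j) * (if j \<in> S then restricted_Stirling S (n - j) k else 0))"
proof -
  let ?A = "{1..n}"
  let ?Q = "block_partitions S"
  let ?X = "SIGMA P : ?Q ?A (Suc k). P"
  let ?Y = "SIGMA B : {B \<in> Pow ?A. card B \<in> S}. ?Q (?A - B) k"
  have finP: "finite P" if "P \<in> ?Q ?A (Suc k)" for P
    using that by (auto simp: block_partitions_def intro: card_ge_0_finite)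
  have "bij_betw (\<lambda>(P, B). (B, P - {B})) ?X ?Y"
  proof (rule bij_betw_byWitness[where f' = "\<lambda>(B, P). (insert B P, B)"])
    show "\<forall>x\<in>?X. (case case x of (P, B) \<Rightarrow> (B, P - {B}) of (B, P) \<Rightarrow> (insert B P, B)) = x"
      by auto
    \<comment> \<open>As 0 is not in \<open>S\<close>, \<open>B\<close> is nonempty; being disjoint
      from all blocks of \<open>P\<close>, it is a new block, so inserting and deleting it are
      mutually inverse.\<close>
    have notin: "B \<notin> P" and disj: "disjnt B (\<Union>P)" if "card B \<in> S" "P \<in> ?Q (?A - B) k" for B P
    proof -
      have "\<Union>P = ?A - B"
        using that partition_onD1[of "?A - B" P] by (auto simp: block_partitions_def)
      then show d: "disjnt B (\<Union>P)"
        by (auto simp: disjnt_iff)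
      have "B \<noteq> {}"
        using that S by auto
      then show "B \<notin> P"
        using d by (auto simp: disjnt_iff)
    qed
    then show "\<forall>y\<in>?Y. (case case y of (B, P) \<Rightarrow> (insert B P, B) of (P, B) \<Rightarrow> (B, P - {B})) = y"
      by auto
    show "(\<lambda>(P, B). (B, P - {B})) ` ?X \<subseteq> ?Y"
    proof (rule image_subsetI)
      fix x assume "x \<in> ?X"
      then obtain P B where x: "x = (P, B)" and P: "P \<in> ?Q ?A (Suc k)" and B: "B \<in> P"
        by blast
      then have p: "partition_on ?A P"
        by (auto simp: block_partitions_def)
      have "disjnt B (\<Union>(P - {B}))"
        using B partition_onD2[OF p] by (auto simp: disjnt_iff disjoint_def)
      \<comment> \<open>The equivalence is read from left to right, with \<open>P\<close> written as
        \<open>insert B (P - {B})\<close>.\<close>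
      from partition_on_insert[OF this, of ?A]
      have "partition_on (?A - B) (P - {B})" "B \<subseteq> ?A"
        using p B by (auto simp: insert_absorb)
      moreover have "card (P - {B}) = k"
        using P B by (auto simp: block_partitions_def)
      ultimately show "(case x of (P, B) \<Rightarrow> (B, P - {B})) \<in> ?Y"
        unfolding x using P B by (auto simp: block_partitions_def)
    qed
    show "(\<lambda>(B, P). (insert B P, B)) ` ?Y \<subseteq> ?X"
    proof (rule image_subsetI)
      fix y assume "y \<in> ?Y"
      then obtain B P where y: "y = (B, P)" and B: "B \<subseteq> ?A" "card B \<in> S"
        and P: "P \<in> ?Q (?A - B) k"
        by blast
      have "B \<noteq> {}"
        using B S by auto
      moreover have "partition_on (?A - B) P"
        using P by (auto simp: block_partitions_def)
      ultimately have "partition_on ?A (insert B P)"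
        using partition_on_insert[OF disj[OF B(2) P], of ?A] B by auto
      moreover have "finite P"
        using finite_elements[OF _ \<open>partition_on (?A - B) P\<close>] by simp
      ultimately show "(case y of (B, P) \<Rightarrow> (insert B P, B)) \<in> ?X"
        unfolding y using P B notin[OF B(2) P] by (auto simp: block_partitions_def)
    qed
  qed
  then have "card ?X = card ?Y"
    by (rule bij_betw_same_card)
  moreover have "card ?X = (\<Sum>P\<in>?Q ?A (Suc k). card P)"
    using finP by (intro card_SigmaI) (auto intro: finite_block_partitions)
  moreover have "\<dots> = Suc k * restricted_Stirling S n (Suc k)"
    using card_block_partitions[of ?A S "Suc k"] by (simp add: block_partitions_def)
  moreover have "card ?Y = (\<Sum>B\<in>{B \<in> Pow ?A. card B \<in> S}. card (?Q (?A - B) k))"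
    by (intro card_SigmaI) (auto intro: finite_block_partitions)
  moreover have "\<dots> = (\<Sum>B\<in>Pow ?A. if card B \<in> S then card (?Q (?A - B) k) else 0)"
    by (rule sum.inter_filter) simp
  \<comment> \<open>Now the summand depends on \<open>B\<close> only through its size, so the
    subsets can be grouped by size.\<close>
  moreover have "\<dots> = (\<Sum>B\<in>Pow ?A. if card B \<in> S then restricted_Stirling S (n - card B) k else 0)"
    by (intro sum.cong) (auto simp: card_block_partitions card_Diff_subset finite_subset)
  moreover have "\<dots> = (\<Sum>j=0..n. (n choose j) * (if j \<in> S then restricted_Stirling S (n - j) k else 0))"
    using sum_Pow_by_card[of ?A "\<lambda>j. if j \<in> S then restricted_Stirling S (n - j) k else 0"] by simp
  ultimately show ?thesis
    by simp
qed

section \<open>Exponential generating functions of the Stirling and Fubini numbers\<close>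

unbundle fps_syntax

definition egf :: "(nat \<Rightarrow> real) \<Rightarrow> real fps" where
  "egf a = Abs_fps (\<lambda>n. a n / fact n)"

lemma egf_nth: "egf a $ n = a n / fact n"
  by (simp add: egf_def)

lemma egf_mult_nth:
  "(egf a * egf b) $ n = (\<Sum>j=0..n. real (n choose j) * a j * b (n - j)) / fact n"
proof -
  have "a j / fact j * (b (n - j) / fact (n - j)) = real (n choose j) * a j * b (n - j) / fact n"
    if "j \<le> n" for j
    using that by (simp add: binomial_fact field_simps)
  then show ?thesis
    by (simp add: fps_mult_nth egf_nth sum_divide_distrib)
qed

definition block_egf :: "nat set \<Rightarrow> real fps" where
  "block_egf S = egf (\<lambda>n. if n \<in> S then 1 else 0)"

lemma block_egf_nth_0: "S \<subseteq> {0<..} \<Longrightarrow> block_egf S $ 0 = 0"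
  by (auto simp: block_egf_def egf_nth)

text \<open>Induction on \<open>k\<close>: the recurrence for a marked block is a binomial
  convolution with the indicator of \<open>S\<close>, that is, a product with
  \<open>block_egf S\<close>. The factor \<open>fact k\<close> avoids a division.\<close>

lemma egf_restricted_Stirling:
  assumes S: "S \<subseteq> {0<..}"
  shows "fps_const (fact k) * egf (\<lambda>n. real (restricted_Stirling S n k)) = block_egf S ^ k"
proof (induction k)
  case 0
  have "restricted_Stirling S n 0 = (if n = 0 then 1 else 0)" for n
  proof (cases "n = 0")
    case False
    have "card P \<noteq> 0" if P: "P \<in> restricted_partitions S n" for P
    proof
      assume "card P = 0"
      \<comment> \<open>Infinite sets also have \<open>card\<close> 0, hence the appeal to
        finiteness.\<close>
      then have "P = {}"
        using restricted_partitions_finite_card(1)[OF P] by simp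
      with P False show False
        by (simp add: restricted_partitions_def partition_on_def)
    qed
    then have "{P \<in> restricted_partitions S n. card P = 0} = {}"
      by blast
    with False show ?thesis
      by (simp only: restricted_Stirling_def card.empty if_False)
  qed (simp add: restricted_Stirling_0_0)
  then show ?case
    by (auto simp: fps_eq_iff egf_nth)
next
  case (Suc k)
  let ?G = "\<lambda>k. egf (\<lambda>n. real (restricted_Stirling S n k))"
  have "fps_const (real (Suc k)) * ?G (Suc k) = block_egf S * ?G k"
  proof (rule fps_ext)
    fix n
    have "real (Suc k) * real (restricted_Stirling S n (Suc k)) =
        (\<Sum>j=0..n. real (n choose j) * (if j \<in> S then 1 else 0) * real (restricted_Stirling S (n - j) k))"
      unfolding of_nat_mult[symmetric] restricted_Stirling_Suc[OF S] of_nat_sum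
      by (intro sum.cong) auto
    then show "(fps_const (real (Suc k)) * ?G (Suc k)) $ n = (block_egf S * ?G k) $ n"
      unfolding block_egf_def egf_mult_nth by (simp add: egf_nth)
  qed
  then have "fps_const (fact k) * (fps_const (real (Suc k)) * ?G (Suc k)) =
      block_egf S * (fps_const (fact k) * ?G k)"
    by (simp only: mult_ac)
  then show ?case
    unfolding Suc.IH by (simp add: mult.assoc[symmetric] mult_ac del: of_nat_Suc)
qed

lemma fact_mult_restricted_Stirling:
  assumes "S \<subseteq> {0<..}"
  shows "fact k * real (restricted_Stirling S n k) = fact n * (block_egf S ^ k) $ n"
  by (simp add: egf_restricted_Stirling[OF assms, symmetric] egf_nth)

lemma fps_power_nth_eq_0:
  fixes f :: "'a::comm_ring_1 fps"
  assumes "f $ 0 = 0" "n < k"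
  shows "(f ^ k) $ n = 0"
  using startsby_zero_power_prefix[OF assms(1)] assms(2) by blast

text \<open>The series is the geometric series in \<open>block_egf S\<close>. No infinite sum is
  needed: without a constant term, only finitely many powers contribute to each coefficient.\<close>

lemma egf_restricted_Fubini:
  assumes S: "S \<subseteq> {0<..}"
  shows "egf (\<lambda>n. real (restricted_Fubini S n)) * (1 - block_egf S) = 1"
proof (rule fps_ext)
  fix n
  let ?E = "block_egf S"
  let ?F = "egf (\<lambda>n. real (restricted_Fubini S n))"
  have E0: "?E $ 0 = 0"
    using S by (rule block_egf_nth_0)
  \<comment> \<open>The bound \<open>n\<close> serves all \<open>m \<le> n\<close>, because powers
    above \<open>m\<close> have no term of degree \<open>m\<close>. Thus one finite sum can replace
    \<open>?F\<close> throughout the convolution.\<close>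
  have nth: "?F $ m = (\<Sum>k\<le>n. ?E ^ k) $ m" if "m \<le> n" for m
  proof -
    have "real (restricted_Fubini S m) = (\<Sum>k=0..m. fact m * (?E ^ k) $ m)"
      by (simp add: restricted_Fubini_eq_sum fact_mult_restricted_Stirling[OF S])
    then have "?F $ m = (\<Sum>k=0..m. (?E ^ k) $ m)"
      by (simp add: egf_nth sum_distrib_left[symmetric])
    also have "\<dots> = (\<Sum>k\<le>n. (?E ^ k) $ m)"
      using that by (intro sum.mono_neutral_left) (auto intro: fps_power_nth_eq_0[OF E0])
    finally show ?thesis
      by (simp add: fps_sum_nth)
  qed
  have "(?F * (1 - ?E)) $ n = ((\<Sum>k\<le>n. ?E ^ k) * (1 - ?E)) $ n"
    by (simp add: fps_mult_nth nth)
  also have "(\<Sum>k\<le>n. ?E ^ k) * (1 - ?E) = 1 - ?E ^ Suc n"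
    using one_diff_power_eq[of ?E "Suc n"] by (simp add: lessThan_Suc_atMost mult.commute)
  \<comment> \<open>The remainder of the telescoped sum starts in degree \<open>n + 1\<close> or
    later.\<close>
  also have "\<dots> $ n = 1 $ n"
    using fps_power_nth_eq_0[OF E0, of n "Suc n"] by simp
  finally show "(?F * (1 - ?E)) $ n = 1 $ n" .
qed

section \<open>Falling factorials and powers of \<open>1 + block_egf S\<close>\<close>

lemma falling_fact_of_nat: "real_of_int (falling_fact (int q) i) = fact i * real (q choose i)"
proof -
  have "real_of_int (falling_fact (int q) i) = (\<Prod>j=0..<i. real q - real j)"
    by (simp add: falling_fact_def lessThan_atLeast0)
  also have "\<dots> = fact i * (real q gchoose i)"
    by (simp only: gbinomial_mult_fact)
  finally show ?thesis
    by (simp add: binomial_gbinomial)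
qed

lemma sum_restricted_Stirling_falling_fact:
  assumes S: "S \<subseteq> {0<..}"
  shows "real_of_int (\<Sum>i=0..n. int (restricted_Stirling S n i) * falling_fact (int q) i) =
    fact n * ((1 + block_egf S) ^ q) $ n"
proof -
  let ?E = "block_egf S"
  have E0: "?E $ 0 = 0"
    using S by (rule block_egf_nth_0)
  have "real_of_int (\<Sum>i=0..n. int (restricted_Stirling S n i) * falling_fact (int q) i) =
      (\<Sum>i=0..n. (fact i * real (restricted_Stirling S n i)) * real (q choose i))"
    by (simp add: falling_fact_of_nat mult_ac)
  also have "\<dots> = fact n * (\<Sum>i=0..n. real (q choose i) * (?E ^ i) $ n)"
    unfolding fact_mult_restricted_Stirling[OF S] by (simp add: sum_distrib_left mult_ac)
  \<comment> \<open>To reach the range of the binomial theorem, the sum is first extended to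
    \<open>max n q\<close>, where the powers with \<open>i > n\<close> contribute 0, and then cut to
    \<open>q\<close>, where the binomial coefficients with \<open>i > q\<close> vanish.\<close>
  also have "(\<Sum>i=0..n. real (q choose i) * (?E ^ i) $ n) =
      (\<Sum>i\<le>max n q. real (q choose i) * (?E ^ i) $ n)"
    by (intro sum.mono_neutral_left) (auto simp: fps_power_nth_eq_0[OF E0])
  also have "\<dots> = (\<Sum>i\<le>q. real (q choose i) * (?E ^ i) $ n)"
    by (intro sum.mono_neutral_right) auto
  also have "\<dots> = ((?E + 1) ^ q) $ n"
    unfolding binomial_ring by (simp add: fps_sum_nth fps_of_nat[symmetric])
  finally show ?thesis
    by (simp add: add.commute)
qed

section \<open>Comparison of coefficients\<close>

theorem theorem6:
  fixes S :: "nat set" and n q :: nat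
  assumes "S \<subseteq> {0<..}" and "n > 0" and "q > 0"
  shows "(2::int) ^ q * int (restricted_Fubini S n) =
    (\<Sum>l=0..n. int (n choose l) * int (restricted_Fubini S l) *
       (\<Sum>i=0..n - l. int (restricted_Stirling S (n - l) i) * falling_fact (int q) i))
    + (\<Sum>l=1..q - 1. 2 ^ (q - l - 1) *
       (\<Sum>i=0..n. int (restricted_Stirling S n i) * falling_fact (int l) i))"
proof -
  let ?E = "block_egf S"
  let ?F = "egf (\<lambda>n. real (restricted_Fubini S n))"
  \<comment> \<open>The first argument is a bound variable, since both the given \<open>q\<close>
    and each smaller \<open>l\<close> are substituted for it.\<close>
  define H where "H = (\<lambda>q n. \<Sum>i=0..n. int (restricted_Stirling S n i) * falling_fact (int q) i)"
  have egf_H: "(1 + ?E) ^ q = egf (\<lambda>n. real_of_int (H q n))" for q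
    unfolding H_def sum_restricted_Stirling_falling_fact[OF assms(1)] by (simp add: fps_eq_iff egf_nth)
  \<comment> \<open>Factorization of a difference of \<open>q\<close>-th powers; the linear factor
    \<open>2 - (1 + ?E)\<close> equals \<open>1 - ?E\<close>, the inverse of
    \<open>?F\<close>.\<close>
  have "2 ^ q - (1 + ?E) ^ q = (1 - ?E) * (\<Sum>l<q. 2 ^ (q - Suc l) * (1 + ?E) ^ l)"
    using power_diff_sumr2[of "1 + ?E" q 2] by (simp add: algebra_simps)
  then have "?F * (2 ^ q - (1 + ?E) ^ q) = (\<Sum>l<q. 2 ^ (q - Suc l) * (1 + ?E) ^ l)"
    using egf_restricted_Fubini[OF assms(1)] by (simp add: mult.assoc[symmetric])
  then have "2 ^ q * ?F = ?F * (1 + ?E) ^ q + (\<Sum>l<q. 2 ^ (q - Suc l) * (1 + ?E) ^ l)"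
    by (simp add: algebra_simps)
  then have coeff: "(2 ^ q * ?F) $ n =
      (?F * (1 + ?E) ^ q) $ n + (\<Sum>l<q. 2 ^ (q - Suc l) * (1 + ?E) ^ l) $ n"
    by simp
  have two: "(2 ^ m * f) $ n = 2 ^ m * f $ n" for m and f :: "real fps"
    by (simp add: numeral_fps_const)
  have "(\<Sum>l<q. 2 ^ (q - Suc l) * (1 + ?E) ^ l) $ n = (\<Sum>l<q. 2 ^ (q - Suc l) * ((1 + ?E) ^ l) $ n)"
    by (simp add: fps_sum_nth two)
  \<comment> \<open>The term \<open>l = 0\<close> is a multiple of the coefficient of degree
    \<open>n\<close> in the series 1, which is 0 as \<open>n > 0\<close>.\<close>
  also have "\<dots> = (\<Sum>l=1..q - 1. 2 ^ (q - l - 1) * ((1 + ?E) ^ l) $ n)"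
    using assms(2,3) by (intro sum.mono_neutral_cong_right) (auto simp: not_le Suc_le_eq)
  also have "\<dots> = (\<Sum>l=1..q - 1. 2 ^ (q - l - 1) * real_of_int (H l n)) / fact n"
    unfolding egf_H egf_nth by (simp add: sum_divide_distrib)
  \<comment> \<open>Both sides are multiplied by \<open>fact n\<close>.\<close>
  finally have "2 ^ q * real (restricted_Fubini S n) =
      (\<Sum>l=0..n. real (n choose l) * real (restricted_Fubini S l) * real_of_int (H q (n - l)))
      + (\<Sum>l=1..q - 1. 2 ^ (q - l - 1) * real_of_int (H l n))"
    using coeff unfolding two egf_H egf_mult_nth by (simp add: egf_nth field_simps)
  then have "real_of_int (2 ^ q * int (restricted_Fubini S n)) =
    real_of_int ((\<Sum>l=0..n. int (n choose l) * int (restricted_Fubini S l) * H q (n - l))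
      + (\<Sum>l=1..q - 1. 2 ^ (q - l - 1) * H l n))"
    by simp
  then show ?thesis
    unfolding H_def by (simp only: of_int_eq_iff)
qed

end
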